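(* Let $\chi$ be a sample space, let $\mathcal{P}\subset\Delta(\chi)$ be any set of probability distributions on $\chi$, let $\theta:\mathcal{P}\to\mathbb{R}$ be a statistic, and let $\mathcal{F}$ be a class of (potentially randomised) estimators. If $\mathcal{F}$ is closed under post-processing (for every $\hat\theta\in\mathcal{F}$ and $f:\mathbb{R}\to\mathbb{R}$, $f\circ\hat\theta\in\mathcal{F}$) and contains all constant functions, then for all $P\in\mathcal{P}$ and all $n\in\mathbb{N}$, $$\mathcal{E}^{\rm loc}_n(P,\mathcal{F},\mathcal{P},\theta)=\tfrac12\,\omega_n(P,\mathcal{F}^{\rm test},\mathcal{P},\theta).$$
   Context: $\Delta(\chi)$ is the set of all probability distributions on $\chi$. An estimator is a (potentially randomised) function $\hat\theta$ mapping samples $(x_1,\dots,x_n)\in\chi^n$ to $\mathbb{R}$. Local error rate of an estimator: $\mathfrak{R}_n(P,\hat\theta)$ is the (smallest) value such that, if $X_1,\dots,X_n\sim P$ are i.i.d., then with probability $0.75$ (over the sample and the randomness of $\hat\theta$), $|\hat\theta(X_1,\dots,X_n)-\theta(P)|\le \mathfrak{R}_n(P,\hat\theta)$. Optimal local estimation rate: $$\mathcal{E}^{\rm loc}_n(P,\mathcal{F},\mathcal{P},\theta)=\sup_{Q\in\mathcal{P}}\ \inf_{\hat\theta\in\mathcal{F}}\ \max\{\mathfrak{R}_n(P,\hat\theta),\mathfrak{R}_n(Q,\hat\theta)\}.$$ Associated tests: $\mathcal{F}^{\rm test}$ is the set of binary functions $T_{f,\tau}$, $f\in\mathcal{F}$,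 $\tau\in\mathbb{R}$, where $T_{f,\tau}(X)=0$ if $f(X)<\tau$ and $T_{f,\tau}(X)=1$ otherwise. For a test $T$, $\mathrm{SC}_T(P,Q)=\inf\{n\in\mathbb{N} : \text{for all } N\ge n,\ \Pr(T(P^N)=0)\ge 0.75 \text{ and } \Pr(T(Q^N)=1)\ge 0.75\}$, where $T(P^N)$ means $T$ applied to $N$ i.i.d. samples from $P$; and $\mathrm{SC}_{\mathcal{F}^{\rm test}}(P,Q)=\inf_{T\in\mathcal{F}^{\rm test}}\mathrm{SC}_T(P,Q)$. That is, $\mathrm{SC}_{\mathcal{F}^{\rm test}}(P,Q)$ is described as the smallest $n$ such that some test $T\in\mathcal{F}^{\rm test}$ distinguishes $P$ and $Q$, where $T$ distinguishes $P$ and $Q$ with $n$ samples if $\Pr(T(P^n)=0)\ge0.75$ and $\Pr(T(Q^n)=1)\ge0.75$. Modulus of continuity: $$\omega_n(P,\mathcal{F}^{\rm test},\mathcal{P},\theta)=\sup\{|\theta(P)-\theta(Q)| : Q\in\mathcal{P},\ \mathrm{SC}_{\mathcal{F}^{\rm test}}(P,Q)>n\}.$$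
   Formalization: Added assumption: for all pairs in the class, SC (infimum over tests of the size from which one test always distinguishes) equals the smallest n at which some test distinguishes. Without it the claim fails, e.g. for an estimator informative only at sample size 1, its post-processings and constants. *)

theory Defs
  imports "HOL-Probability.Probability"
begin

text \<open>
  A randomised function of samples is a family of Markov kernels, one for each sample size;
  a sample of size \<open>n\<close> is an element of the product space indexed by \<open>{..<n}\<close>.
  The set of all probability distributions on a sample space \<open>M\<close> is \<open>space (prob_algebra M)\<close>.
\<close>

type_synonym ('a, 'b) randomised = "nat \<Rightarrow> (nat \<Rightarrow> 'a) \<Rightarrow> 'b measure"
type_synonym 'a estimator = "('a, real) randomised"
type_synonym 'a test = "('a, nat) randomised"

definition samples :: "nat \<Rightarrow> 'a measure \<Rightarrow> (nat \<Rightarrow> 'a) measure" where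
  "samples n P = (\<Pi>\<^sub>M i\<in>{..<n}. P)"

definition estimators :: "'a measure \<Rightarrow> 'a estimator set" where
  "estimators M = {e. \<forall>n. e n \<in> samples n M \<rightarrow>\<^sub>M prob_algebra borel}"

definition output_law :: "('a, 'b) randomised \<Rightarrow> nat \<Rightarrow> 'a measure \<Rightarrow> 'b measure" where
  "output_law k n P = samples n P \<bind> k n"

definition const_estimator :: "real \<Rightarrow> 'a estimator" where
  "const_estimator c = (\<lambda>n x. return borel c)"

definition post_process :: "(real \<Rightarrow> real) \<Rightarrow> 'a estimator \<Rightarrow> 'a estimator" where
  "post_process f e = (\<lambda>n x. distr (e n x) borel f)"

definition local_error :: "nat \<Rightarrow> ('a measure \<Rightarrow> real) \<Rightarrow> 'a measure \<Rightarrow> 'a estimator \<Rightarrow> real" where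
  "local_error n \<theta> P e =
     Inf {r. measure (output_law e n P) {y. \<bar>y - \<theta> P\<bar> \<le> r} \<ge> 0.75}"

definition local_rate ::
  "nat \<Rightarrow> 'a measure \<Rightarrow> 'a estimator set \<Rightarrow> 'a measure set \<Rightarrow> ('a measure \<Rightarrow> real) \<Rightarrow> ennreal"
where
  "local_rate n P F \<P> \<theta> =
     (SUP Q\<in>\<P>. INF e\<in>F. ennreal (max (local_error n \<theta> P e) (local_error n \<theta> Q e)))"

definition threshold_test :: "'a estimator \<Rightarrow> real \<Rightarrow> 'a test" where
  "threshold_test e \<tau> =
     (\<lambda>n x. distr (e n x) (count_space {0, 1}) (\<lambda>y. if y < \<tau> then 0 else 1))"

definition tests :: "'a estimator set \<Rightarrow> 'a test set" where
  "tests F = {threshold_test e \<tau> | e \<tau>. e \<in> F}"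

definition distinguishes :: "'a test \<Rightarrow> nat \<Rightarrow> 'a measure \<Rightarrow> 'a measure \<Rightarrow> bool" where
  "distinguishes T n P Q \<longleftrightarrow>
     measure (output_law T n P) {0} \<ge> 0.75 \<and> measure (output_law T n Q) {1} \<ge> 0.75"

definition SC_test :: "'a test \<Rightarrow> 'a measure \<Rightarrow> 'a measure \<Rightarrow> enat" where
  "SC_test T P Q = Inf {enat n | n. \<forall>N\<ge>n. distinguishes T N P Q}"

definition SC :: "'a test set \<Rightarrow> 'a measure \<Rightarrow> 'a measure \<Rightarrow> enat" where
  "SC \<T> P Q = (INF T\<in>\<T>. SC_test T P Q)"

text \<open>
  The smallest sample size at which some test of the class distinguishes. It is used as an
  alternative description of \<^const>\<open>SC\<close>, but agrees with it only if distinguishability at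
  \<open>n\<close> samples persists, by a single test, for all larger sample sizes. Classes that may ignore
  surplus samples have this property; see \<open>SC_eq_least_distinguishing\<close> below.
\<close>

definition least_distinguishing :: "'a test set \<Rightarrow> 'a measure \<Rightarrow> 'a measure \<Rightarrow> enat" where
  "least_distinguishing \<T> P Q = Inf {enat n | n. \<exists>T\<in>\<T>. distinguishes T n P Q}"

definition modulus ::
  "nat \<Rightarrow> 'a measure \<Rightarrow> 'a test set \<Rightarrow> 'a measure set \<Rightarrow> ('a measure \<Rightarrow> real) \<Rightarrow> ennreal"
where
  "modulus n P \<T> \<P> \<theta> = Sup {ennreal \<bar>\<theta> P - \<theta> Q\<bar> | Q. Q \<in> \<P> \<and> SC \<T> P Q > enat n}"

definition truncate_samples :: "nat \<Rightarrow> ('a, 'b) randomised \<Rightarrow> ('a, 'b) randomised" where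
  "truncate_samples k e = (\<lambda>n x. e (min n k) (restrict x {..<min n k}))"

lemma output_law_truncate_samples:
  assumes P: "P \<in> space (prob_algebra M)"
    and e: "e k \<in> samples k M \<rightarrow>\<^sub>M prob_algebra B" and "k \<le> n"
  shows "output_law (truncate_samples k e) n P = output_law e k P"
proof -
  interpret P: prob_space P using P by (simp add: space_prob_algebra)
  interpret PP: product_prob_space "\<lambda>_::nat. P" "{..<n}" by unfold_locales
  have setsP: "sets P = sets M" using P by (simp add: space_prob_algebra)
  have "sets (samples k P) = sets (samples k M)"
    unfolding samples_def by (intro sets_PiM_cong refl setsP)
  then have ek: "e k \<in> samples k P \<rightarrow>\<^sub>M subprob_algebra B"
    using measurable_prob_algebraD[OF e] by (simp cong: measurable_cong_sets)
  have sub: "{..<k} \<subseteq> {..<n}" using \<open>k \<le> n\<close> by auto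
  have r: "(\<lambda>x. restrict x {..<k}) \<in> samples n P \<rightarrow>\<^sub>M samples k P"
    unfolding samples_def by (rule measurable_restrict_subset[OF sub])
  have d: "distr (samples n P) (samples k P) (\<lambda>x. restrict x {..<k}) = samples k P"
    unfolding samples_def by (rule PP.distr_PiM_restrict_finite[OF _ sub]) simp
  have "space (samples n P) \<noteq> {}"
    unfolding samples_def by (rule PP.not_empty)
  then have "samples k P \<bind> e k = samples n P \<bind> (\<lambda>x. e k (restrict x {..<k}))"
    using bind_distr[OF r ek] d by simp
  then show ?thesis
    unfolding output_law_def truncate_samples_def using \<open>k \<le> n\<close> by (simp add: min_absorb2)
qed

lemma SC_eq_least_distinguishing:
  assumes F: "F \<subseteq> estimators M" and trunc: "\<And>e k. e \<in> F \<Longrightarrow> truncate_samples k e \<in> F"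
    and P: "P \<in> space (prob_algebra M)" and Q: "Q \<in> space (prob_algebra M)"
  shows "SC (tests F) P Q = least_distinguishing (tests F) P Q"
proof (rule antisym)
  show "least_distinguishing (tests F) P Q \<le> SC (tests F) P Q"
    unfolding SC_def SC_test_def least_distinguishing_def
    by (intro INF_greatest Inf_superset_mono) auto
next
  show "SC (tests F) P Q \<le> least_distinguishing (tests F) P Q"
    unfolding least_distinguishing_def
  proof (rule Inf_greatest, clarsimp)
    fix k T assume T: "T \<in> tests F" and D: "distinguishes T k P Q"
    obtain e \<tau> where e: "e \<in> F" and Te: "T = threshold_test e \<tau>"
      using T by (auto simp: tests_def)
    have Tt: "truncate_samples k T = threshold_test (truncate_samples k e) \<tau>"
      by (simp add: Te truncate_samples_def threshold_test_def)
    have "truncate_samples k T \<in> tests F"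
      using trunc[OF e] by (auto simp: Tt tests_def)
    moreover have "e k \<in> samples k M \<rightarrow>\<^sub>M prob_algebra borel"
      using e F by (auto simp: estimators_def)
    then have "T k \<in> samples k M \<rightarrow>\<^sub>M prob_algebra (count_space {0, 1})"
      unfolding Te threshold_test_def
      by (rule measurable_compose) (rule measurable_distr_prob_space, measurable)
    then have "\<forall>N\<ge>k. distinguishes (truncate_samples k T) N P Q"
      using D by (simp add: distinguishes_def output_law_truncate_samples[OF P]
          output_law_truncate_samples[OF Q])
    then have "SC_test (truncate_samples k T) P Q \<le> enat k"
      unfolding SC_test_def by (intro Inf_lower) auto
    ultimately show "SC (tests F) P Q \<le> enat k"
      unfolding SC_def by (meson INF_lower2)
  qed
qed

end

theory Submission
  imports Defs
begin

text \<open>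
  This is Le Cam's two-point argument, exact because of post-processing. If a threshold test
  distinguishes \<open>P\<close> from \<open>Q\<close> with \<open>n\<close> samples, relabelling its two outcomes by \<open>\<theta> P\<close> and \<open>\<theta> Q\<close>
  gives an estimator whose local error is \<open>0\<close> at both distributions. Otherwise the constant
  estimator at the midpoint of \<open>\<theta> P\<close> and \<open>\<theta> Q\<close> has error \<open>\<bar>\<theta> P - \<theta> Q\<bar> / 2\<close> at both, and no
  estimator does better, since thresholding a better one at the midpoint would distinguish them.
\<close>

section \<open>Output laws of kernels under sampling and push-forward\<close>

text \<open>Estimators are measurable for the reference space \<open>M\<close>, whereas
  \<open>output_law\<close> integrates over samples from \<open>P\<close>; the two product
  sigma-algebras coincide because \<open>P\<close> lives on that of \<open>M\<close>.\<close>

lemma samples_kernel: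
  assumes P: "P \<in> space (prob_algebra M)" and e: "e n \<in> samples n M \<rightarrow>\<^sub>M prob_algebra B"
  shows "e n \<in> samples n P \<rightarrow>\<^sub>M prob_algebra B" and "prob_space (samples n P)"
proof -
  interpret P: prob_space P using P by (simp add: space_prob_algebra)
  interpret PP: product_prob_space "\<lambda>_::nat. P" "{..<n}" by unfold_locales
  have "sets P = sets M" using P by (simp add: space_prob_algebra)
  then have "sets (samples n P) = sets (samples n M)"
    unfolding samples_def by (intro sets_PiM_cong refl)
  then show "e n \<in> samples n P \<rightarrow>\<^sub>M prob_algebra B"
    using e by (simp cong: measurable_cong_sets)
  show "prob_space (samples n P)"
    unfolding samples_def by (rule PP.prob_space_axioms)
qed

lemma output_law_in_prob_algebra:
  assumes "P \<in> space (prob_algebra M)" and "e n \<in> samples n M \<rightarrow>\<^sub>M prob_algebra B"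
  shows "output_law e n P \<in> space (prob_algebra B)"
  \<comment> \<open>Bind is a measurable map between spaces of probability measures, so it sends the
    point \<open>samples n P\<close> into the target space.\<close>
  unfolding output_law_def using samples_kernel[of P M e n, OF assms]
  by (intro measurable_space[OF measurable_bind_prob_space[OF measurable_ident_sets[OF refl]],
        where x = "samples n P"]) (simp_all add: space_prob_algebra)

text \<open>Push-forward commutes with averaging over the sample. Post-processing and thresholding
  are both instances, so every probability below reduces to one under the law of the original
  estimator.\<close>

lemma output_law_distr:
  assumes "P \<in> space (prob_algebra M)" and "e n \<in> samples n M \<rightarrow>\<^sub>M prob_algebra B"
    and "f \<in> B \<rightarrow>\<^sub>M N"
  shows "output_law (\<lambda>n x. distr (e n x) N f) n P = distr (output_law e n P) N f"
proof -
  note k = samples_kernel[of P M e n, OF assms(1,2)]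
  show ?thesis
    unfolding output_law_def
    by (rule distr_bind[symmetric, OF measurable_prob_algebraD[OF k(1)]
          prob_space.not_empty[OF k(2)] assms(3)])
qed

section \<open>The law and local error of one estimator at one distribution\<close>

context
  fixes M :: "'a measure" and P :: "'a measure" and e :: "'a estimator" and n :: nat
  assumes P: "P \<in> space (prob_algebra M)" and e: "e \<in> estimators M"
begin

lemma estimator_measurable: "e n \<in> samples n M \<rightarrow>\<^sub>M prob_algebra borel"
  using e by (simp add: estimators_def)

lemma prob_space_output_law: "prob_space (output_law e n P)"
  and sets_output_law: "sets (output_law e n P) = sets borel"
  using output_law_in_prob_algebra[of P M e n, OF P estimator_measurable]
  by (auto simp: space_prob_algebra)

lemma space_output_law: "space (output_law e n P) = UNIV"
  using sets_eq_imp_space_eq[OF sets_output_law] by simp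

lemma measure_output_law_post_process:
  assumes f: "f \<in> borel_measurable borel" and A: "A \<in> sets borel"
  shows "measure (output_law (post_process f e) n P) A = measure (output_law e n P) (f -` A)"
proof -
  have "output_law (post_process f e) n P = distr (output_law e n P) borel f"
    unfolding post_process_def by (rule output_law_distr[of P M e n, OF P estimator_measurable f])
  moreover have "f \<in> output_law e n P \<rightarrow>\<^sub>M borel"
    using f by (simp add: measurable_cong_sets[OF sets_output_law refl])
  ultimately show ?thesis
    using A by (simp add: measure_distr space_output_law)
qed

lemma measure_output_law_threshold_test:
  shows "measure (output_law (threshold_test e \<tau>) n P) {0} = measure (output_law e n P) {y. y < \<tau>}"
    and "measure (output_law (threshold_test e \<tau>) n P) {1} = measure (output_law e n P) {y. \<tau> \<le> y}"
proof -
  let ?f = "\<lambda>y::real. if y < \<tau> then 0 else 1 :: nat"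
  have f: "?f \<in> borel \<rightarrow>\<^sub>M count_space {0, 1}" by measurable
  have eq: "output_law (threshold_test e \<tau>) n P = distr (output_law e n P) (count_space {0, 1}) ?f"
    unfolding threshold_test_def by (rule output_law_distr[of P M e n, OF P estimator_measurable f])
  have "?f \<in> output_law e n P \<rightarrow>\<^sub>M count_space {0, 1}"
    using f by (simp add: measurable_cong_sets[OF sets_output_law refl])
  note m = measure_distr[OF this]
  have "?f -` {0} = {y. y < \<tau>}" "?f -` {1} = {y. \<tau> \<le> y}" by (auto split: if_splits)
  then show "measure (output_law (threshold_test e \<tau>) n P) {0} = measure (output_law e n P) {y. y < \<tau>}"
    "measure (output_law (threshold_test e \<tau>) n P) {1} = measure (output_law e n P) {y. \<tau> \<le> y}"
    unfolding eq by (simp_all add: m space_output_law del: One_nat_def)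
qed

lemma confidence_radius_nonneg:
  assumes "measure (output_law e n P) {y. \<bar>y - \<theta> P\<bar> \<le> r} \<ge> 0.75"
  shows "0 \<le> r"
proof (rule ccontr)
  assume "\<not> 0 \<le> r"
  then have "{y. \<bar>y - \<theta> P\<bar> \<le> r} = {}" by auto
  then show False using assms by simp
qed

text \<open>Intervals of integer radius exhaust the line, so continuity from below applies. With
  nonnegativity of radii, this makes the real \<open>Inf\<close> in \<open>local_error\<close> a
  genuine infimum of a nonempty set bounded below.\<close>

lemma confidence_radius_exists:
  "\<exists>r. measure (output_law e n P) {y. \<bar>y - \<theta> P\<bar> \<le> r} \<ge> 0.75"
proof -
  interpret prob_space "output_law e n P" by (rule prob_space_output_law)
  let ?A = "\<lambda>m::nat. {y. \<bar>y - \<theta> P\<bar> \<le> real m}"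
  have "(\<Union>m. ?A m) = UNIV" using real_arch_simple by auto
  moreover have "range ?A \<subseteq> sets (output_law e n P)" by (auto simp: sets_output_law)
  moreover have "incseq ?A" by (rule incseq_SucI) auto
  ultimately have "(\<lambda>m. prob (?A m)) \<longlonglongrightarrow> 1"
    using finite_Lim_measure_incseq[of ?A] prob_space by (simp add: space_output_law)
  then have "eventually (\<lambda>m. prob (?A m) > 0.75) sequentially"
    by (rule order_tendstoD) simp
  then obtain m where "prob (?A m) > 0.75"
    by (auto simp: eventually_sequentially)
  then show ?thesis by (intro exI[of _ "real m"]) simp
qed

lemma local_error_le:
  assumes "measure (output_law e n P) {y. \<bar>y - \<theta> P\<bar> \<le> r} \<ge> 0.75"
  shows "local_error n \<theta> P e \<le> r"
  unfolding local_error_def using assms confidence_radius_nonneg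
  by (intro cInf_lower bdd_belowI[of _ 0]) auto

lemma local_error_nonneg: "0 \<le> local_error n \<theta> P e"
  unfolding local_error_def using confidence_radius_exists confidence_radius_nonneg
  by (intro cInf_greatest) auto

text \<open>The strict inequality avoids any question of whether the infimum is attained: some
  admissible radius lies below \<open>r\<close>, and its closed interval sits inside the open one of
  radius \<open>r\<close>.\<close>

lemma measure_ge_of_local_error_less:
  assumes r: "local_error n \<theta> P e < r"
    and A: "A \<in> sets borel" "\<And>y. \<bar>y - \<theta> P\<bar> < r \<Longrightarrow> y \<in> A"
  shows "measure (output_law e n P) A \<ge> 0.75"
proof -
  interpret prob_space "output_law e n P" by (rule prob_space_output_law)
  obtain s where s: "prob {y. \<bar>y - \<theta> P\<bar> \<le> s} \<ge> 0.75" "s < r"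
    using cInf_lessD[OF _ r[unfolded local_error_def]] confidence_radius_exists by auto
  have "prob {y. \<bar>y - \<theta> P\<bar> \<le> s} \<le> prob A"
    using s A by (intro finite_measure_mono) (auto simp: sets_output_law)
  with s show ?thesis by simp
qed

end

section \<open>Sample complexity as an attained minimum\<close>

lemma enat_Inf_in:
  fixes A :: "enat set"
  assumes "A \<noteq> {}"
  shows "Inf A \<in> A"
  using assms by (auto intro: wellorder_InfI)

lemma SC_test_le_imp_distinguishes:
  assumes "SC_test T P Q \<le> enat n"
  shows "distinguishes T n P Q"
proof -
  let ?S = "{enat n | n. \<forall>N\<ge>n. distinguishes T N P Q}"
  \<comment> \<open>The infimum of the empty set in \<open>enat\<close> is infinity, which is not
    below \<open>enat n\<close>.\<close>
  have "?S \<noteq> {}"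
    using assms unfolding SC_test_def by (auto simp: Inf_enat_def split: if_splits)
  then have "SC_test T P Q \<in> ?S"
    unfolding SC_test_def by (rule enat_Inf_in)
  then obtain k where "SC_test T P Q = enat k" "\<forall>N\<ge>k. distinguishes T N P Q"
    by blast
  with assms show ?thesis by simp
qed

text \<open>From left to right, both nested infima are minima by well-ordering, and a test that
  works from some size \<open>k \<le> n\<close> onwards works at \<open>n\<close>. The converse
  rests on the assumed equality: a test that succeeds at \<open>n\<close> may fail at larger sizes,
  and so bounds only \<open>least_distinguishing\<close> directly.\<close>

lemma SC_le_iff:
  assumes "SC \<T> P Q = least_distinguishing \<T> P Q"
  shows "SC \<T> P Q \<le> enat n \<longleftrightarrow> (\<exists>T\<in>\<T>. distinguishes T n P Q)"
proof
  assume "SC \<T> P Q \<le> enat n"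
  then have le: "Inf ((\<lambda>T. SC_test T P Q) ` \<T>) \<le> enat n" by (simp add: SC_def)
  then have "(\<lambda>T. SC_test T P Q) ` \<T> \<noteq> {}" by (auto simp: Inf_enat_def)
  then have "Inf ((\<lambda>T. SC_test T P Q) ` \<T>) \<in> (\<lambda>T. SC_test T P Q) ` \<T>"
    by (rule enat_Inf_in)
  then obtain T where "T \<in> \<T>" "SC_test T P Q \<le> enat n" using le by auto
  then show "\<exists>T\<in>\<T>. distinguishes T n P Q" by (auto intro: SC_test_le_imp_distinguishes)
next
  assume "\<exists>T\<in>\<T>. distinguishes T n P Q"
  then show "SC \<T> P Q \<le> enat n"
    unfolding assms least_distinguishing_def by (intro Inf_lower) auto
qed

section \<open>The two-point comparison of estimation and testing\<close>

lemma local_error_zero_of_distinguishes: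
  assumes P: "P \<in> space (prob_algebra M)" and Q: "Q \<in> space (prob_algebra M)"
    and F: "F \<subseteq> estimators M"
    and post: "\<And>e f. e \<in> F \<Longrightarrow> f \<in> borel_measurable borel \<Longrightarrow> post_process f e \<in> F"
    and T: "T \<in> tests F" "distinguishes T n P Q"
  shows "\<exists>e\<in>F. local_error n \<theta> P e = 0 \<and> local_error n \<theta> Q e = 0"
proof -
  obtain e \<tau> where e: "e \<in> F" and Te: "T = threshold_test e \<tau>"
    using T by (auto simp: tests_def)
  have eM: "e \<in> estimators M" using e F by auto
  define f where "f y = (if y < \<tau> then \<theta> P else \<theta> Q)" for y
  have f: "f \<in> borel_measurable borel" unfolding f_def by measurable
  define e' where "e' = post_process f e"
  have e': "e' \<in> F" unfolding e'_def by (rule post[OF e f])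
  then have e'M: "e' \<in> estimators M" using F by auto
  \<comment> \<open>Radius 0 is admissible at \<open>R\<close> once the relabelling equals
    \<open>\<theta> R\<close> on an event of probability at least 0.75. The events used are the two
    sides of the threshold.\<close>
  have zero: "local_error n \<theta> R e' = 0"
    if R: "R \<in> space (prob_algebra M)" and A: "measure (output_law e n R) A \<ge> 0.75"
      "A \<in> sets borel" "\<And>y. y \<in> A \<Longrightarrow> f y = \<theta> R" for R A
  proof -
    interpret prob_space "output_law e n R" by (rule prob_space_output_law[OF R eM])
    have "prob A \<le> prob (f -` {\<theta> R})"
      using A measurable_sets[OF f, of "{\<theta> R}"]
      by (intro finite_measure_mono) (auto simp: sets_output_law[OF R eM])
    moreover have "{y. \<bar>y - \<theta> R\<bar> \<le> 0} = {\<theta> R}" by auto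
    ultimately have "measure (output_law e' n R) {y. \<bar>y - \<theta> R\<bar> \<le> 0} \<ge> 0.75"
      using A by (simp add: e'_def measure_output_law_post_process[OF R eM f])
    from local_error_le[where \<theta> = \<theta>, OF R e'M this] local_error_nonneg[OF R e'M]
    show ?thesis by (rule antisym)
  qed
  have "measure (output_law e n P) {y. y < \<tau>} \<ge> 0.75"
    "measure (output_law e n Q) {y. \<tau> \<le> y} \<ge> 0.75"
    using T(2) unfolding distinguishes_def Te measure_output_law_threshold_test[OF P eM]
      measure_output_law_threshold_test[OF Q eM] by blast+
  note zero[OF P this(1)] zero[OF Q this(2)]
  then have "local_error n \<theta> P e' = 0" "local_error n \<theta> Q e' = 0"
    by (simp_all add: f_def)
  then show ?thesis using e' by auto
qed

text \<open>The open intervals around \<open>\<theta> P\<close> and \<open>\<theta> Q\<close> with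
  radius half the gap lie on opposite sides of the midpoint, and each carries probability at least
  0.75 under its own law.\<close>

lemma distinguishes_of_local_error_less:
  assumes P: "P \<in> space (prob_algebra M)" and Q: "Q \<in> space (prob_algebra M)"
    and F: "F \<subseteq> estimators M"
    and post: "\<And>e f. e \<in> F \<Longrightarrow> f \<in> borel_measurable borel \<Longrightarrow> post_process f e \<in> F"
    and e: "e \<in> F"
    and less: "local_error n \<theta> P e < \<bar>\<theta> P - \<theta> Q\<bar> / 2" "local_error n \<theta> Q e < \<bar>\<theta> P - \<theta> Q\<bar> / 2"
  shows "\<exists>T\<in>tests F. distinguishes T n P Q"
proof -
  have eM: "e \<in> estimators M" using e F by auto
  let ?m = "(\<theta> P + \<theta> Q) / 2"
  note ge = measure_ge_of_local_error_less[OF P eM less(1)]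
    measure_ge_of_local_error_less[OF Q eM less(2)]
  show ?thesis
  proof (cases "\<theta> P \<le> \<theta> Q")
    case True
    have "measure (output_law e n P) {y. y < ?m} \<ge> 0.75"
      using True by (intro ge(1)) (auto simp: abs_if field_simps split: if_splits)
    moreover have "measure (output_law e n Q) {y. ?m \<le> y} \<ge> 0.75"
      using True by (intro ge(2)) (auto simp: abs_if field_simps split: if_splits)
    ultimately have "distinguishes (threshold_test e ?m) n P Q"
      unfolding distinguishes_def measure_output_law_threshold_test[OF P eM]
        measure_output_law_threshold_test[OF Q eM] ..
    then show ?thesis using e by (auto simp: tests_def)
  next
    case False
    \<comment> \<open>A threshold test answers 0 below its threshold, but here \<open>P\<close> has
      the larger parameter. Negating the estimator reverses the order; the midpoint itself still
      goes to answer 1, hence the strict inequality for \<open>P\<close> below.\<close>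
    have e': "post_process uminus e \<in> F" by (rule post[OF e]) measurable
    then have e'M: "post_process uminus e \<in> estimators M" using F by auto
    have "measure (output_law e n P) {y. ?m < y} \<ge> 0.75"
      using False by (intro ge(1)) (auto simp: abs_if field_simps split: if_splits)
    moreover have "measure (output_law e n Q) {y. y \<le> ?m} \<ge> 0.75"
      using False by (intro ge(2)) (auto simp: abs_if field_simps split: if_splits)
    moreover have "uminus -` {y. y < - ?m} = {y. ?m < y}" "uminus -` {y. - ?m \<le> y} = {y. y \<le> ?m}"
      by auto
    moreover have "{y. y < - ?m} \<in> sets borel" "{y. - ?m \<le> y} \<in> sets borel" by measurable
    moreover have "uminus \<in> borel_measurable (borel :: real measure)" by measurable
    ultimately have "distinguishes (threshold_test (post_process uminus e) (- ?m)) n P Q"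
      unfolding distinguishes_def measure_output_law_threshold_test[OF P e'M]
        measure_output_law_threshold_test[OF Q e'M]
      by (simp only: measure_output_law_post_process[OF P eM]
          measure_output_law_post_process[OF Q eM])
    then show ?thesis using e' by (auto simp: tests_def)
  qed
qed

text \<open>The output law is the point mass at \<open>c\<close>, and the interval around
  \<open>\<theta> P\<close> that just reaches \<open>c\<close> has full mass.\<close>

lemma local_error_const_estimator_le:
  assumes P: "P \<in> space (prob_algebra M)"
    and c: "const_estimator c \<in> estimators M"
  shows "local_error n \<theta> P (const_estimator c) \<le> \<bar>c - \<theta> P\<bar>"
proof (rule local_error_le[OF P c])
  have "prob_space (samples n P)"
    using P c by (intro samples_kernel(2)[of P M "const_estimator c"]) (auto simp: estimators_def)
  then have "output_law (const_estimator c) n P = return borel c"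
    unfolding output_law_def const_estimator_def
    by (intro bind_const' prob_space_imp_subprob_space prob_space_return) simp_all
  then show "measure (output_law (const_estimator c) n P) {y. \<bar>y - \<theta> P\<bar> \<le> \<bar>c - \<theta> P\<bar>} \<ge> 0.75"
    by (simp add: measure_return)
qed

text \<open>For a fixed pair the optimal error takes only two possible values, and the sample size
  decides between them solely through distinguishability. This is the pointwise form of the main
  identity.\<close>

lemma INF_local_error:
  assumes P: "P \<in> space (prob_algebra M)" and Q: "Q \<in> space (prob_algebra M)"
    and F: "F \<subseteq> estimators M"
    and post: "\<And>e f. e \<in> F \<Longrightarrow> f \<in> borel_measurable borel \<Longrightarrow> post_process f e \<in> F"
    and const: "\<And>c. const_estimator c \<in> F"
  shows "(INF e\<in>F. ennreal (max (local_error n \<theta> P e) (local_error n \<theta> Q e))) =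
    (if \<exists>T\<in>tests F. distinguishes T n P Q then 0 else ennreal (\<bar>\<theta> P - \<theta> Q\<bar> / 2))"
proof (cases "\<exists>T\<in>tests F. distinguishes T n P Q")
  case True
  then obtain e where "e \<in> F" "local_error n \<theta> P e = 0" "local_error n \<theta> Q e = 0"
    using local_error_zero_of_distinguishes[OF P Q F post] by blast
  then have "(INF e\<in>F. ennreal (max (local_error n \<theta> P e) (local_error n \<theta> Q e))) \<le> 0"
    by (intro INF_lower2[of e]) auto
  with True show ?thesis by simp
next
  case False
  let ?c = "(\<theta> P + \<theta> Q) / 2"
  have c: "const_estimator ?c \<in> estimators M" using const F by auto
  have "\<bar>?c - \<theta> P\<bar> = \<bar>\<theta> P - \<theta> Q\<bar> / 2" "\<bar>?c - \<theta> Q\<bar> = \<bar>\<theta> P - \<theta> Q\<bar> / 2"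
    by (auto simp: abs_if field_simps)
  then have "max (local_error n \<theta> P (const_estimator ?c)) (local_error n \<theta> Q (const_estimator ?c))
      \<le> \<bar>\<theta> P - \<theta> Q\<bar> / 2"
    using local_error_const_estimator_le[OF P c, of n \<theta>]
      local_error_const_estimator_le[OF Q c, of n \<theta>] by simp
  then have "(INF e\<in>F. ennreal (max (local_error n \<theta> P e) (local_error n \<theta> Q e)))
      \<le> ennreal (\<bar>\<theta> P - \<theta> Q\<bar> / 2)"
    using const by (intro INF_lower2[of "const_estimator ?c"] ennreal_leI) auto
  moreover have "ennreal (\<bar>\<theta> P - \<theta> Q\<bar> / 2)
      \<le> (INF e\<in>F. ennreal (max (local_error n \<theta> P e) (local_error n \<theta> Q e)))"
  proof (intro INF_greatest ennreal_leI)
    fix e assume e: "e \<in> F"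
    show "\<bar>\<theta> P - \<theta> Q\<bar> / 2 \<le> max (local_error n \<theta> P e) (local_error n \<theta> Q e)"
    proof (rule ccontr)
      assume "\<not> ?thesis"
      then have "local_error n \<theta> P e < \<bar>\<theta> P - \<theta> Q\<bar> / 2" "local_error n \<theta> Q e < \<bar>\<theta> P - \<theta> Q\<bar> / 2"
        by linarith+
      from distinguishes_of_local_error_less[OF P Q F post e this] False show False by blast
    qed
  qed
  ultimately show ?thesis using False by simp
qed

text \<open>The inner infimum is evaluated for each \<open>Q\<close>, and
  \<open>SC_description\<close> turns distinguishability at \<open>n\<close> into a bound on
  \<open>SC\<close>. By \<open>SC_eq_least_distinguishing\<close>, classes of estimators closed
  under truncation of samples satisfy that hypothesis.\<close>

theorem proposition2p1:
  fixes M :: "'a measure" and \<P> :: "'a measure set" and \<theta> :: "'a measure \<Rightarrow> real"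
    and F :: "'a estimator set" and P :: "'a measure" and n :: nat
  assumes "\<P> \<subseteq> space (prob_algebra M)"
    and "F \<subseteq> estimators M"
    and post_processing: "\<And>e f. e \<in> F \<Longrightarrow> f \<in> borel_measurable borel \<Longrightarrow> post_process f e \<in> F"
    and constants: "\<And>c. const_estimator c \<in> F"
    and SC_description: "\<And>P' Q'. P' \<in> \<P> \<Longrightarrow> Q' \<in> \<P> \<Longrightarrow>
           SC (tests F) P' Q' = least_distinguishing (tests F) P' Q'"
    and "P \<in> \<P>"
  shows "local_rate n P F \<P> \<theta> = (1/2) * modulus n P (tests F) \<P> \<theta>"
proof -
  let ?S = "{Q \<in> \<P>. SC (tests F) P Q > enat n}"
  have half: "ennreal (d / 2) = 1/2 * ennreal d" if "0 \<le> d" for d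
  proof -
    have "ennreal (d / 2) = ennreal d / 2" using that by (simp add: divide_ennreal[symmetric])
    then show ?thesis by (simp add: divide_ennreal_def mult.commute)
  qed
  have "local_rate n P F \<P> \<theta> =
      (SUP Q\<in>\<P>. if SC (tests F) P Q \<le> enat n then 0 else ennreal (\<bar>\<theta> P - \<theta> Q\<bar> / 2))"
    unfolding local_rate_def
  proof (rule SUP_cong[OF refl])
    fix Q assume Q: "Q \<in> \<P>"
    then have PQ: "P \<in> space (prob_algebra M)" "Q \<in> space (prob_algebra M)"
      using assms(1) \<open>P \<in> \<P>\<close> by auto
    show "(INF e\<in>F. ennreal (max (local_error n \<theta> P e) (local_error n \<theta> Q e))) =
        (if SC (tests F) P Q \<le> enat n then 0 else ennreal (\<bar>\<theta> P - \<theta> Q\<bar> / 2))"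
      unfolding SC_le_iff[OF SC_description[OF \<open>P \<in> \<P>\<close> Q]]
      by (rule INF_local_error[OF PQ assms(2) post_processing constants])
  qed
  \<comment> \<open>The discarded terms are 0, the least element of \<open>ennreal\<close>, so the
    equality also covers an empty \<open>?S\<close>, where both sides are 0.\<close>
  also have "\<dots> = (SUP Q\<in>?S. ennreal (\<bar>\<theta> P - \<theta> Q\<bar> / 2))"
  proof (rule antisym)
    show "(SUP Q\<in>\<P>. if SC (tests F) P Q \<le> enat n then 0 else ennreal (\<bar>\<theta> P - \<theta> Q\<bar> / 2))
        \<le> (SUP Q\<in>?S. ennreal (\<bar>\<theta> P - \<theta> Q\<bar> / 2))"
    proof (rule SUP_least)
      fix Q assume "Q \<in> \<P>"
      then show "(if SC (tests F) P Q \<le> enat n then 0 else ennreal (\<bar>\<theta> P - \<theta> Q\<bar> / 2))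
          \<le> (SUP Q\<in>?S. ennreal (\<bar>\<theta> P - \<theta> Q\<bar> / 2))"
        by (cases "SC (tests F) P Q \<le> enat n") (auto intro: SUP_upper)
    qed
    show "(SUP Q\<in>?S. ennreal (\<bar>\<theta> P - \<theta> Q\<bar> / 2))
        \<le> (SUP Q\<in>\<P>. if SC (tests F) P Q \<le> enat n then 0 else ennreal (\<bar>\<theta> P - \<theta> Q\<bar> / 2))"
      by (rule SUP_subset_mono) (auto simp: not_le)
  qed
  also have "\<dots> = (SUP Q\<in>?S. 1/2 * ennreal \<bar>\<theta> P - \<theta> Q\<bar>)"
    by (intro SUP_cong refl half abs_ge_zero)
  also have "\<dots> = 1/2 * (SUP Q\<in>?S. ennreal \<bar>\<theta> P - \<theta> Q\<bar>)"
    by (rule SUP_mult_left_ennreal[symmetric])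
  also have "(SUP Q\<in>?S. ennreal \<bar>\<theta> P - \<theta> Q\<bar>) = modulus n P (tests F) \<P> \<theta>"
    unfolding modulus_def by (rule arg_cong[where f = Sup]) auto
  finally show ?thesis .
qed

end
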